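(* Let $d\ge 2$. For each $n\in\mathbb{N}$ let $X_1^{(n)},\dots,X_n^{(n)}$ be independent random points in the closed halfsphere $\mathbb{S}_e^+\subset\mathbb{S}^d$, each with the uniform distribution $\mu$, and let $P_n$ be their spherical convex hull. Assume that, writing $A_n=(X_1^{(n)},\dots,X_n^{(n)})$, the sequence $A_1,A_2,\dots$ is independent. Then $$\mathbb{P}\left(\delta_s(P_n,\mathbb{S}_e^+)\ge c\,\frac{\ln n}{n}\ \text{ for infinitely many } n\right)=1,\qquad\text{with } c=\frac{\omega_{d+1}}{5\,\omega_d}.$$
   Context: $d\ge 2$ is an integer; $\mathbb{S}^d$ is the unit sphere of $\mathbb{R}^{d+1}$ with standard scalar product $\langle\cdot,\cdot\rangle$; $\sigma$ is the spherical Lebesgue measure on $\mathbb{S}^d$. For $k\ge 1$, $\omega_k=2\pi^{k/2}/\Gamma(k/2)$ (so $\omega_{d+1}=\sigma(\mathbb{S}^d)$). Fix $e\in\mathbb{S}^d$; $\mathbb{S}_e^+=\{u\in\mathbb{S}^d:\langle u,e\rangle\ge 0\}$, and $\mu=\frac{2}{\omega_{d+1}}\,\sigma$ restricted to $\mathbb{S}_e^+$ is the uniform probability measure on $\mathbb{S}_e^+$. The spherical convex hull is $\mathrm{conv}_s(A)=\mathbb{S}^d\cap\mathrm{pos}\,A$, where $\mathrm{pos}$ denotes the positive hull in $\mathbb{R}^{d+1}$ (the set of all finite linear combinations with nonnegative coefficients). The spherical distance is $d_s(x,y)=\arccos\langle x,y\rangle$, and the spherical Hausdorff distance of nonempty compact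 $K,M\subset\mathbb{S}^d$ is $\delta_s(K,M)=\max\{\max_{x\in K}\min_{y\in M}d_s(x,y),\ \max_{x\in M}\min_{y\in K}d_s(x,y)\}$. *)

theory Defs
  imports "HOL-Probability.Probability"
begin

definition omega :: "nat \<Rightarrow> real" where
  "omega k = 2 * pi powr (real k / 2) / Gamma (real k / 2)"

text \<open>
  Spherical Lebesgue measure on the unit sphere, as a Borel measure whose underlying space is the
  sphere itself: a Borel set \<open>A\<close> of unit vectors has measure \<open>DIM('a)\<close> times the Lebesgue volume
  of the punctured cone \<open>{t *\<^sub>R u | u \<in> A, 0 < t < 1}\<close>. On the punctured ball, \<open>sgn x\<close> is the
  radial projection \<open>x /\<^sub>R norm x\<close>. The normalization is confirmed in \<open>emeasure_sphere_measure\<close>.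
\<close>

definition sphere_measure :: "'a::euclidean_space measure" where
  "sphere_measure =
     distr (scale_measure (of_nat DIM('a)) (restrict_space lborel (ball 0 1 - {0})))
       (restrict_space borel (sphere 0 1)) sgn"

definition halfsphere :: "'a::euclidean_space \<Rightarrow> 'a set" where
  "halfsphere e = {u \<in> sphere 0 1. u \<bullet> e \<ge> 0}"

definition halfsphere_uniform :: "'a::euclidean_space \<Rightarrow> 'a measure" where
  "halfsphere_uniform e =
     scale_measure (ennreal (2 / omega DIM('a))) (restrict_space sphere_measure (halfsphere e))"

definition pos_hull :: "'a::real_vector set \<Rightarrow> 'a set" where
  "pos_hull A = {\<Sum>a\<in>F. c a *\<^sub>R a | F c. finite F \<and> F \<subseteq> A \<and> (\<forall>a\<in>F. c a \<ge> (0::real))}"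

definition sph_conv :: "'a::euclidean_space set \<Rightarrow> 'a set" where
  "sph_conv A = sphere 0 1 \<inter> pos_hull A"

definition sph_dist :: "'a::euclidean_space \<Rightarrow> 'a \<Rightarrow> real" where
  "sph_dist x y = arccos (x \<bullet> y)"

text \<open>
  Meaningful only for nonempty compact subsets of the unit sphere; there all suprema and infima
  below are attained, so they are the maxima and minima of the usual definition.
\<close>

definition sph_hausdorff :: "'a::euclidean_space set \<Rightarrow> 'a set \<Rightarrow> real" where
  "sph_hausdorff K M =
     max (SUP x\<in>K. INF y\<in>M. sph_dist x y) (SUP x\<in>M. INF y\<in>K. sph_dist x y)"

lemma space_sphere_measure [simp]: "space (sphere_measure :: 'a::euclidean_space measure) = sphere 0 1"
  by (simp add: sphere_measure_def space_restrict_space)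

lemma emeasure_sphere_measure:
  "emeasure (sphere_measure :: 'a::euclidean_space measure) (sphere 0 1) = ennreal (omega DIM('a))"
proof -
  let ?N = "scale_measure (of_nat DIM('a)) (restrict_space lborel (ball (0::'a) 1 - {0}))"
  have "(sgn :: 'a \<Rightarrow> 'a) \<in> borel_measurable borel"
    unfolding sgn_div_norm by measurable
  then have "sgn \<in> restrict_space lborel (ball (0::'a) 1 - {0}) \<rightarrow>\<^sub>M borel"
    by (intro measurable_restrict_space1) simp
  then have meas: "sgn \<in> ?N \<rightarrow>\<^sub>M restrict_space borel (sphere 0 1)"
    by (intro measurable_restrict_space2)
       (auto simp: space_scale_measure space_restrict_space norm_sgn measurable_cong_sets[OF sets_scale_measure refl])
  have "emeasure (sphere_measure :: 'a measure) (sphere 0 1)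
      = emeasure ?N (sgn -` sphere 0 1 \<inter> space ?N)"
    unfolding sphere_measure_def
    by (rule emeasure_distr[OF meas]) (auto simp: sets_restrict_space image_iff intro!: bexI[of _ UNIV])
  also have "sgn -` sphere 0 1 \<inter> space ?N = ball (0::'a) 1 - {0}"
    by (auto simp: space_scale_measure space_restrict_space norm_sgn)
  also have "emeasure ?N \<dots> = of_nat DIM('a) * emeasure lborel (ball (0::'a) 1 - {0})"
    by (simp add: emeasure_restrict_space)
  also have "emeasure lborel (ball (0::'a) 1 - {0}) = emeasure lborel (ball (0::'a) 1)"
    by (intro emeasure_Diff_null_set) (auto simp: null_sets_def)
  also have "\<dots> = ennreal (unit_ball_vol (real DIM('a)))"
    using emeasure_ball[of 1 "0::'a"] by simp
  also have "of_nat DIM('a) * \<dots> = ennreal (real DIM('a) * unit_ball_vol (real DIM('a)))"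
    by (simp add: ennreal_mult' ennreal_of_nat_eq_real_of_nat)
  also have "real DIM('a) * unit_ball_vol (real DIM('a)) = omega DIM('a)"
  proof -
    have nz: "real DIM('a) / 2 \<notin> \<int>\<^sub>\<le>\<^sub>0"
      using nonpos_Ints_nonpos[of "real DIM('a) / 2"] DIM_positive[where 'a='a] by fastforce
    have "k * (p / (k / 2 * G)) = 2 * p / G" if "G > 0" "k > 0" for G k p :: real
      using that by (simp add: field_simps)
    moreover have "Gamma (real DIM('a) / 2) > 0"
      by (intro Gamma_real_pos) simp
    ultimately show ?thesis
      unfolding omega_def unit_ball_vol_def Gamma_plus1[OF nz] by simp
  qed
  finally show ?thesis .
qed

end

theory Submission
  imports Defs
begin

text \<open>
  Fix a unit vector \<open>z\<close> orthogonal to \<open>e\<close> and let \<open>v = tilt e z t\<close> be \<open>e\<close> rotated by the angle \<open>t\<close>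
  away from \<open>z\<close>. If no point falls into the lune \<open>{x \<in> halfsphere e. x \<bullet> v < 0}\<close>, then the spherical
  hull lies in the halfspace of \<open>v\<close>, whose points have distance at least \<open>t\<close> from \<open>z\<close>, so a single
  lune forces Hausdorff distance at least \<open>t\<close>. Reflecting a lune in its tilted side yields an
  adjacent one, so halving the angle at least halves the measure, and the lune of angle
  \<open>pi / 2 ^ k\<close> has measure at most \<open>1 / 2 ^ k\<close>. Choosing \<open>pi / 2 ^ k\<close> between
  \<open>s = c * ln n / n\<close> and \<open>2 * s\<close>, the event at stage \<open>n\<close> has probability at least
  \<open>(1 - 2 * s / pi) ^ n \<ge> 1 / n\<close>, because \<open>c \<le> 2 / 5\<close>. The stages are independent and the harmonic
  series diverges, so the second Borel--Cantelli lemma applies.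
\<close>

subsection \<open>The second Borel--Cantelli lemma\<close>

text \<open>Independence and \<open>1 - p <= exp (- p)\<close> bound the probability that no event
  occurs from stage \<open>m\<close> to \<open>m + N\<close> by the exponential of minus a partial
  sum. Starting the index set at \<open>k\<close> makes it possible to leave out the stage without
  points.\<close>

lemma (in prob_space) borel_cantelli_indep_AE:
  fixes E :: "nat \<Rightarrow> 'a set"
  assumes indep: "indep_events E {k..}"
    and div: "\<not> summable (\<lambda>n. prob (E n))"
  shows "AE w in M. \<exists>\<^sub>\<infinity>n. w \<in> E n"
proof -
  have ev: "E n \<in> events" if "n \<ge> k" for n
    using indep that by (auto simp: indep_events_def)
  have tail: "AE w in M. \<exists>n\<ge>m. w \<in> E n" if "m \<ge> k" for m
  proof -
    define C where "C n = space M - E n" for n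
    have Cev: "C n \<in> events" if "n \<ge> k" for n
      using ev[OF that] by (simp add: C_def)
    \<comment> \<open>To pass to complements, the singleton families, which are trivially closed
      under intersection, are enlarged to the sigma-algebras they generate; these contain
      \<open>C i\<close>.\<close>
    have "indep_sets (\<lambda>i. sigma_sets (space M) {E i}) {k..}"
      using indep by (intro indep_sets_sigma) (auto simp: indep_events_def_alt Int_stable_def)
    then have "indep_sets (\<lambda>i. {C i}) {k..}"
      by (rule indep_sets_mono_sets) (auto simp: C_def intro: sigma_sets.intros)
    then have indC: "indep_events C {k..}"
      by (simp add: indep_events_def_alt)
    define B where "B = (\<Inter>n\<in>{m..}. C n)"
    have B_ev: "B \<in> events"
      unfolding B_def using Cev that by (intro sets.countable_INT) auto
    have bound: "prob B \<le> exp (- (\<Sum>n\<in>{m..m+N}. prob (E n)))" for N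
    proof -
      have "prob B \<le> prob (\<Inter>n\<in>{m..m+N}. C n)"
        using Cev that by (intro finite_measure_mono sets.finite_INT) (auto simp: B_def)
      also have "\<dots> = (\<Prod>n\<in>{m..m+N}. prob (C n))"
        using indC that unfolding indep_events_def by auto
      also have "\<dots> \<le> (\<Prod>n\<in>{m..m+N}. exp (- prob (E n)))"
      proof (intro prod_mono conjI)
        fix n assume "n \<in> {m..m+N}"
        then have "prob (C n) = 1 - prob (E n)"
          using ev that by (simp add: C_def prob_compl)
        then show "prob (C n) \<le> exp (- prob (E n))"
          using exp_ge_add_one_self[of "- prob (E n)"] by simp
      qed simp
      also have "\<dots> = exp (- (\<Sum>n\<in>{m..m+N}. prob (E n)))"
        by (simp add: exp_sum sum_negf[symmetric] del: sum_negf)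
      finally show ?thesis .
    qed
    have "prob B = 0"
    \<comment> \<open>If \<open>prob B\<close> were positive, \<open>- ln (prob B)\<close> would
      bound all partial sums of the divergent series.\<close>
    proof (rule ccontr)
      assume "prob B \<noteq> 0"
      then have pos: "prob B > 0" by (simp add: less_le)
      have S: "(\<Sum>n\<in>{m..m+N}. prob (E n)) \<le> - ln (prob B)" for N
      proof -
        have "ln (prob B) \<le> ln (exp (- (\<Sum>n\<in>{m..m+N}. prob (E n))))"
          using bound[of N] pos by (subst ln_le_cancel_iff) auto
        then show ?thesis by simp
      qed
      have "summable (\<lambda>n. prob (E (n + m)))"
      proof (rule bounded_imp_summable)
        fix N
        have "(\<Sum>n\<le>N. prob (E (n + m))) = (\<Sum>n\<in>{m..m+N}. prob (E n))"
          by (rule sum.reindex_bij_witness[of _ "\<lambda>n. n - m" "\<lambda>n. n + m"]) auto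
        then show "(\<Sum>n\<le>N. prob (E (n + m))) \<le> - ln (prob B)" using S by simp
      qed simp
      then show False
        using div summable_iff_shift[of "\<lambda>n. prob (E n)" m] by simp
    qed
    then have "AE w in M. w \<notin> B"
      using B_ev by (simp add: prob_eq_0)
    then show ?thesis by (rule AE_mp) (auto simp: B_def C_def)
  qed
  have "AE w in M. \<forall>m. \<exists>n\<ge>m + k. w \<in> E n"
    unfolding AE_all_countable using tail by simp
  then show ?thesis
  proof (rule AE_mp, intro AE_I2 impI)
    fix w assume "\<forall>m. \<exists>n\<ge>m + k. w \<in> E n"
    then show "\<exists>\<^sub>\<infinity>n. w \<in> E n"
      unfolding INFM_nat_le by (meson le_add1 order_trans)
  qed
qed

subsection \<open>Reflections and wedges\<close>

text \<open>
  By Vitali's covering theorem an open set is a disjoint union of balls up to a null set, and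
  balls of equal radius have equal volume.
\<close>

lemma emeasure_lborel_open_le_isometry_image:
  fixes f :: "'a::euclidean_space \<Rightarrow> 'a"
  assumes U: "open U" and V: "V \<in> sets lborel" "f ` U \<subseteq> V"
    and ball: "\<And>x r. f ` ball x r = ball (f x) r" and inj: "inj f"
  shows "emeasure lborel U \<le> emeasure lborel V"
proof -
  let ?K = "{(x, r). 0 < r \<and> ball x r \<subseteq> U}"
  obtain C where C: "countable C" "C \<subseteq> ?K"
     and dis: "pairwise (\<lambda>i j. disjnt (ball (fst i) (snd i)) (ball (fst j) (snd j))) C"
     and neg: "negligible (U - (\<Union>i \<in> C. ball (fst i) (snd i)))"
  proof (rule Vitali_covering_theorem_balls[of U ?K fst snd])
    fix x and d :: real assume "x \<in> U" "d > 0"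
    then obtain k where "k > 0" "ball x k \<subseteq> U"
      using U openE by blast
    then show "\<exists>i. i \<in> ?K \<and> x \<in> ball (fst i) (snd i) \<and> snd i < d"
      using \<open>d > 0\<close> by (intro exI[of _ "(x, min k (d/2))"]) (auto simp: subset_iff)
  qed
  let ?B = "\<lambda>i. ball (fst i) (snd i)" and ?B' = "\<lambda>i. ball (f (fst i)) (snd i)"
  have eqU: "(\<Union>i\<in>C. ?B i) \<subseteq> U" using C(2) by fastforce
  have null: "U - (\<Union>i\<in>C. ?B i) \<in> null_sets lborel"
  proof -
    \<comment> \<open>\<open>negligible\<close> only speaks of the completed measure; Borel
      measurability of the remainder brings the null set down to \<open>lborel\<close>.\<close>
    have "U - (\<Union>i\<in>C. ?B i) \<in> sets borel"
      using U by (intro sets.Diff borel_open) auto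
    then show ?thesis using neg
      by (simp add: negligible_iff_null_sets null_sets_completion_iff)
  qed
  have img: "(\<Union>i\<in>C. ?B' i) \<subseteq> V"
  proof -
    have "?B' i \<subseteq> V" if "i \<in> C" for i
      using that C(2) V(2) unfolding ball[symmetric] by force
    then show ?thesis by blast
  qed
  have d1: "disjoint_family_on ?B C"
    using dis unfolding disjoint_family_on_def pairwise_def disjnt_def by blast
  have d2: "disjoint_family_on ?B' C"
  proof -
    have "?B' i \<inter> ?B' j = {}" if "i \<in> C" "j \<in> C" "i \<noteq> j" for i j
    proof -
      have "?B' i \<inter> ?B' j = f ` (?B i \<inter> ?B j)"
        unfolding ball[symmetric] using image_Int[OF inj] by blast
      then show ?thesis using d1 that by (auto simp: disjoint_family_on_def)
    qed
    then show ?thesis unfolding disjoint_family_on_def by blast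
  qed
  have rad: "snd i > 0" if "i \<in> C" for i using that C(2) by force
  have "emeasure lborel U = emeasure lborel ((\<Union>i\<in>C. ?B i) \<union> (U - (\<Union>i\<in>C. ?B i)))"
    using eqU by (simp add: Un_absorb1)
  also have "\<dots> = emeasure lborel (\<Union>i\<in>C. ?B i)"
    using null by (intro emeasure_Un_null_set) (auto intro: borel_open)
  also have "\<dots> = (\<integral>\<^sup>+i. emeasure lborel (?B i) \<partial>count_space C)"
    by (rule emeasure_UN_countable[OF _ C(1) d1]) auto
  also have "\<dots> = (\<integral>\<^sup>+i. emeasure lborel (?B' i) \<partial>count_space C)"
    by (intro nn_integral_cong) (use rad in \<open>simp add: emeasure_ball less_imp_le\<close>)
  also have "\<dots> = emeasure lborel (\<Union>i\<in>C. ?B' i)"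
    by (rule emeasure_UN_countable[OF _ C(1) d2, symmetric]) auto
  also have "\<dots> \<le> emeasure lborel V"
    using img V(1) by (rule emeasure_mono)
  finally show ?thesis .
qed

definition reflect :: "'a::real_inner \<Rightarrow> 'a \<Rightarrow> 'a" where
  "reflect v x = x - (2 * (x \<bullet> v)) *\<^sub>R v"

lemma reflect_reflect:
  assumes "norm v = 1" shows "reflect v (reflect v x) = x"
proof -
  have "v \<bullet> v = 1" using assms by (simp add: dot_square_norm)
  then show ?thesis by (simp add: reflect_def inner_diff_left algebra_simps)
qed

lemma inner_reflect_reflect:
  assumes "norm v = 1" shows "reflect v x \<bullet> reflect v y = x \<bullet> y"
proof -
  have "v \<bullet> v = 1" using assms by (simp add: dot_square_norm)
  then show ?thesis by (simp add: reflect_def inner_diff_left inner_diff_right inner_commute algebra_simps)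
qed

lemma dist_reflect:
  assumes "norm v = 1" shows "dist (reflect v x) (reflect v y) = dist x y"
proof -
  have "reflect v x - reflect v y = reflect v (x - y)"
    by (simp add: reflect_def inner_diff_left algebra_simps)
  then show ?thesis
    by (simp add: dist_norm norm_eq_sqrt_inner inner_reflect_reflect[OF assms])
qed

lemma inner_reflect_left:
  "reflect v x \<bullet> y = x \<bullet> reflect v y"
  by (simp add: reflect_def inner_diff_left inner_diff_right inner_commute algebra_simps)

lemma image_reflect_ball:
  assumes "norm v = 1" shows "reflect v ` ball x r = ball (reflect v x) r"
proof (intro equalityI subsetI)
  fix y assume "y \<in> ball (reflect v x) r"
  then have "reflect v y \<in> ball x r"
    using dist_reflect[OF assms, of x "reflect v y"] by (simp add: reflect_reflect[OF assms])
  then show "y \<in> reflect v ` ball x r"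
    using reflect_reflect[OF assms, of y] by (metis imageI)
qed (auto simp: dist_reflect[OF assms])

text \<open>This is the open cone over a lune inside the unit ball. The strict inequalities make it
  open, as the covering argument requires; \<open>wedge e (- e)\<close> is the open
  half-ball.\<close>

definition wedge :: "'a::euclidean_space \<Rightarrow> 'a \<Rightarrow> 'a set" where
  "wedge e v = {x \<in> ball 0 1. x \<bullet> e > 0 \<and> x \<bullet> v < 0}"

lemma open_wedge: "open (wedge e v)"
proof -
  have "wedge e v = ball 0 1 \<inter> {x. 0 < x \<bullet> e} \<inter> {x. x \<bullet> v < 0}"
    by (auto simp: wedge_def)
  then show ?thesis
    by (auto intro!: open_Int open_Collect_less continuous_intros)
qed

text \<open>
  The reflection in the hyperplane orthogonal to \<open>v\<close> maps the wedge between \<open>e\<close> and \<open>v\<close>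
  to the adjacent wedge between \<open>v\<close> and \<open>- reflect v e\<close>.
\<close>

lemma emeasure_wedge_double:
  fixes e v :: "'a::euclidean_space"
  assumes v: "norm v = 1" and c: "e \<bullet> v \<ge> 0"
  shows "2 * emeasure lborel (wedge e v) \<le> emeasure lborel (wedge e (- reflect v e))"
proof -
  let ?W = "wedge e v" and ?R = "reflect v"
  \<comment> \<open>The mirror image of \<open>?W\<close> lies on the other side of the hyperplane
    of \<open>v\<close>, hence is disjoint from \<open>?W\<close>.\<close>
  define W' where "W' = {x \<in> ball 0 1. x \<bullet> v > 0 \<and> x \<bullet> ?R e > 0}"
  have vv: "v \<bullet> v = 1" using v by (simp add: dot_square_norm)
  have Rv: "?R v = - v" by (simp add: reflect_def vv scaleR_2)
  have eR: "x \<bullet> ?R e = x \<bullet> e - 2 * (e \<bullet> v) * (x \<bullet> v)" for x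
    by (simp add: reflect_def inner_diff_right inner_commute)
  have "W' = wedge v (- ?R e)" by (auto simp: W'_def wedge_def)
  then have oW': "open W'" by (simp add: open_wedge)
  have im: "?R ` ?W \<subseteq> W'"
  proof
    fix y assume "y \<in> ?R ` ?W"
    then obtain x where x: "x \<in> ?W" "y = ?R x" by blast
    have "norm y = norm x"
      using x inner_reflect_reflect[OF v, of x x] by (simp add: norm_eq_sqrt_inner)
    then show "y \<in> W'"
      using x by (auto simp: W'_def wedge_def inner_reflect_reflect[OF v] inner_reflect_left[of v x v] Rv)
  qed
  have inj: "inj ?R" by (metis injI reflect_reflect[OF v])
  have le: "emeasure lborel ?W \<le> emeasure lborel W'"
    using oW' im by (intro emeasure_lborel_open_le_isometry_image[OF open_wedge _ _ image_reflect_ball[OF v] inj]) auto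
  have "2 * emeasure lborel ?W \<le> emeasure lborel ?W + emeasure lborel W'"
    using le by (simp add: mult_2 add_left_mono)
  also have "\<dots> = emeasure lborel (?W \<union> W')"
    using oW' open_wedge[of e v] by (intro plus_emeasure) (auto simp: wedge_def W'_def)
  also have "\<dots> \<le> emeasure lborel (wedge e (- ?R e))"
  proof (rule emeasure_mono)
    show "wedge e (- ?R e) \<in> sets lborel" using borel_open[OF open_wedge] by simp
    show "?W \<union> W' \<subseteq> wedge e (- ?R e)"
    proof
      fix x assume x: "x \<in> ?W \<union> W'"
      \<comment> \<open>Here \<open>e \<bullet> v \<ge> 0\<close> enters: on \<open>?W\<close> the
        term \<open>2 * (e \<bullet> v) * (x \<bullet> v)\<close> is at most 0, which keeps
        \<open>x \<bullet> (- ?R e)\<close> negative; on \<open>W'\<close> it is at least 0, which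
        keeps \<open>x \<bullet> e\<close> positive.\<close>
      have s: "(e \<bullet> v) * (x \<bullet> v) \<le> 0" if "x \<bullet> v < 0" using that c by (simp add: mult_nonneg_nonpos)
      have s': "(e \<bullet> v) * (x \<bullet> v) \<ge> 0" if "x \<bullet> v > 0" using that c by simp
      show "x \<in> wedge e (- ?R e)"
        using x s s' by (auto simp: wedge_def W'_def eR)
    qed
  qed
  finally show ?thesis .
qed

subsection \<open>The measure of a lune\<close>

lemma space_halfsphere_uniform [simp]: "space (halfsphere_uniform e) = halfsphere e"
  by (auto simp: halfsphere_uniform_def space_scale_measure space_restrict_space halfsphere_def)

lemma sets_sphere_measure: "sets sphere_measure = sets (restrict_space borel (sphere (0::'a::euclidean_space) 1))"
  by (simp add: sphere_measure_def)

lemma closed_halfsphere: "closed (halfsphere e)"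
proof -
  have "halfsphere e = sphere 0 1 \<inter> {u. 0 \<le> u \<bullet> e}" by (auto simp: halfsphere_def)
  then show ?thesis by (auto intro!: closed_Int closed_Collect_le continuous_intros)
qed

lemma sets_halfsphere_uniform:
  "sets (halfsphere_uniform e) = sets (restrict_space borel (halfsphere e))"
proof -
  have "sets (halfsphere_uniform e) = sets (restrict_space (restrict_space borel (sphere 0 1)) (halfsphere e))"
    by (simp add: halfsphere_uniform_def sets_restrict_space_cong[OF sets_sphere_measure])
  moreover have "halfsphere e \<subseteq> sphere 0 1" by (auto simp: halfsphere_def)
  ultimately show ?thesis
    by (simp add: sets_restrict_restrict_space Int_absorb1)
qed

lemma sphere_halfsphere: "halfsphere e \<subseteq> sphere 0 1"
  by (auto simp: halfsphere_def)

lemma in_sets_halfsphere_uniform_iff: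
  "A \<in> sets (halfsphere_uniform e) \<longleftrightarrow> A \<in> sets borel \<and> A \<subseteq> halfsphere e"
  using closed_halfsphere[of e]
  by (auto simp: sets_halfsphere_uniform sets_restrict_space_iff)

lemma measurable_sgn_borel: "(sgn :: 'a::euclidean_space \<Rightarrow> 'a) \<in> borel_measurable borel"
  unfolding sgn_div_norm by measurable

text \<open>Turns statements about \<open>halfsphere_uniform\<close> into statements about Lebesgue
  volumes of cones, to which the reflection argument applies.\<close>

lemma emeasure_halfsphere_uniform:
  fixes e :: "'a::euclidean_space"
  assumes A: "A \<in> sets (halfsphere_uniform e)"
  shows "emeasure (halfsphere_uniform e) A =
    ennreal (2 / omega DIM('a)) * of_nat DIM('a) * emeasure lborel {x \<in> ball 0 1 - {0}. sgn x \<in> A}"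
proof -
  let ?N = "scale_measure (of_nat DIM('a)) (restrict_space lborel (ball (0::'a) 1 - {0}))"
  have A': "A \<in> sets borel" "A \<subseteq> halfsphere e" "A \<subseteq> sphere 0 1"
    using A by (auto simp: in_sets_halfsphere_uniform_iff halfsphere_def)
  have "sgn \<in> restrict_space lborel (ball (0::'a) 1 - {0}) \<rightarrow>\<^sub>M borel"
    by (intro measurable_restrict_space1) (simp add: measurable_sgn_borel)
  then have meas: "sgn \<in> ?N \<rightarrow>\<^sub>M restrict_space borel (sphere 0 1)"
    by (intro measurable_restrict_space2)
       (auto simp: space_scale_measure space_restrict_space norm_sgn measurable_cong_sets[OF sets_scale_measure refl])
  have As: "A \<in> sets (restrict_space borel (sphere 0 1))"
    using A' by (auto simp: sets_restrict_space_iff)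
  have hs: "halfsphere e \<in> sets (restrict_space borel (sphere 0 1))"
    using closed_halfsphere[of e] by (auto simp: sets_restrict_space_iff halfsphere_def)
  have "emeasure (halfsphere_uniform e) A = ennreal (2 / omega DIM('a)) * emeasure sphere_measure A"
    unfolding halfsphere_uniform_def using A' hs
    by (simp add: emeasure_restrict_space sets_sphere_measure Int_absorb2 sphere_halfsphere)
  also have "emeasure sphere_measure A = emeasure ?N (sgn -` A \<inter> space ?N)"
    unfolding sphere_measure_def by (rule emeasure_distr[OF meas As])
  also have "sgn -` A \<inter> space ?N = {x \<in> ball 0 1 - {0}. sgn x \<in> A}"
    by (auto simp: space_scale_measure space_restrict_space)
  also have "emeasure ?N {x \<in> ball 0 1 - {0}. sgn x \<in> A}
      = of_nat DIM('a) * emeasure lborel {x \<in> ball 0 1 - {0}. sgn x \<in> A}"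
    by (simp add: emeasure_restrict_space subset_eq)
  finally show ?thesis by (simp add: mult.assoc)
qed

section \<open>Tilted normals and lunes of dyadic angle\<close>

definition tilt :: "'a::real_vector \<Rightarrow> 'a \<Rightarrow> real \<Rightarrow> 'a" where
  "tilt e z t = cos t *\<^sub>R e - sin t *\<^sub>R z"

lemma inner_tilt:
  assumes "norm e = 1" "e \<bullet> z = 0"
  shows "e \<bullet> tilt e z t = cos t"
  using assms by (simp add: tilt_def inner_diff_right dot_square_norm)

lemma norm_tilt:
  assumes "norm e = 1" "norm z = 1" "e \<bullet> z = 0"
  shows "norm (tilt e z t) = 1"
proof -
  have "e \<bullet> e = 1" "z \<bullet> z = 1" using assms by (simp_all add: dot_square_norm)
  then have "tilt e z t \<bullet> tilt e z t = (cos t)\<^sup>2 + (sin t)\<^sup>2"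
    using assms(3) by (simp add: tilt_def inner_diff_left inner_diff_right inner_commute[of z e] power2_eq_square)
  then show ?thesis by (simp add: norm_eq_sqrt_inner)
qed

text \<open>The negative reflection is the mirror image of \<open>e\<close> in the line spanned by
  the tilted vector, so the angle from \<open>e\<close> doubles; the double-angle formulas express
  this.\<close>

lemma reflect_tilt:
  assumes "norm e = 1" "e \<bullet> z = 0"
  shows "- reflect (tilt e z t) e = tilt e z (2 * t)"
proof -
  have "- reflect (tilt e z t) e = (2 * cos t) *\<^sub>R tilt e z t - e"
    by (simp add: reflect_def inner_tilt[OF assms])
  also have "\<dots> = (2 * (cos t)\<^sup>2 - 1) *\<^sub>R e - (2 * sin t * cos t) *\<^sub>R z"
    by (simp add: tilt_def algebra_simps power2_eq_square)
  also have "2 * (cos t)\<^sup>2 - 1 = cos (2 * t)" by (rule cos_double_cos[symmetric])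
  also have "2 * sin t * cos t = sin (2 * t)" by (rule sin_double[symmetric])
  finally show ?thesis by (simp add: tilt_def)
qed

lemma emeasure_wedge_tilt_dyadic:
  fixes e z :: "'a::euclidean_space"
  assumes "norm e = 1" "norm z = 1" "e \<bullet> z = 0"
  shows "2 ^ k * emeasure lborel (wedge e (tilt e z (pi / 2 ^ k))) \<le> emeasure lborel (wedge e (- e))"
proof (induction k)
  case 0
  then show ?case by (simp add: tilt_def)
next
  case (Suc k)
  define t where "t = pi / 2 ^ Suc k"
  \<comment> \<open>An angle with exponent \<open>Suc k\<close> is at most \<open>pi / 2\<close>, so
    its cosine satisfies the sign condition of \<open>emeasure_wedge_double\<close>.\<close>
  have "(1::real) \<le> 2 ^ k" by simp
  then have t: "0 \<le> t" "t \<le> pi / 2"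
    by (auto simp: t_def field_simps)
  have "2 ^ Suc k * emeasure lborel (wedge e (tilt e z t))
      = 2 ^ k * (2 * emeasure lborel (wedge e (tilt e z t)))"
    by (simp add: mult_ac)
  also have "\<dots> \<le> 2 ^ k * emeasure lborel (wedge e (- reflect (tilt e z t) e))"
    using t assms cos_ge_zero[of t]
    by (intro mult_left_mono emeasure_wedge_double) (auto simp: norm_tilt inner_tilt)
  also have "- reflect (tilt e z t) e = tilt e z (pi / 2 ^ k)"
    using assms by (simp add: reflect_tilt t_def)
  also note Suc
  finally show ?case by (simp add: t_def)
qed

lemma borel_Collect_sgn:
  fixes A :: "'a::euclidean_space set"
  assumes "A \<in> sets borel"
  shows "{x \<in> ball 0 1 - {0}. sgn x \<in> A} \<in> sets borel"
proof -
  have "sgn -` A \<in> sets borel"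
    using measurable_sets[OF measurable_sgn_borel assms] by simp
  moreover have "{x \<in> ball 0 1 - {0}. sgn x \<in> A} = (ball 0 1 - {0}) \<inter> sgn -` A" by auto
  ultimately show ?thesis by auto
qed

lemma sets_lune: "{x \<in> halfsphere e. x \<bullet> v < 0} \<in> sets (halfsphere_uniform e)"
proof -
  have "{x \<in> halfsphere e. x \<bullet> v < 0} = halfsphere e \<inter> {x. x \<bullet> v < 0}" by auto
  then show ?thesis
    using closed_halfsphere[of e]
    by (auto simp: in_sets_halfsphere_uniform_iff intro!: borel_open open_Collect_less continuous_intros)
qed

text \<open>The cone over the lune lies in a wedge up to a null set, and that wedge has at most the
  fraction \<open>1 / 2 ^ k\<close> of the half-ball, which in turn lies in the cone over the
  halfsphere.\<close>

lemma measure_lune_le: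
  fixes e z :: "'a::euclidean_space"
  assumes ez: "norm e = 1" "norm z = 1" "e \<bullet> z = 0"
    and P: "prob_space (halfsphere_uniform e)"
  shows "measure (halfsphere_uniform e) {x \<in> halfsphere e. x \<bullet> tilt e z (pi / 2 ^ k) < 0} \<le> 1 / 2 ^ k"
proof -
  interpret prob_space "halfsphere_uniform e" by (rule P)
  let ?v = "tilt e z (pi / 2 ^ k)"
  let ?L = "{x \<in> halfsphere e. x \<bullet> ?v < 0}"
  \<comment> \<open>The normalizing factor is carried along unevaluated; the total mass one of the
    halfsphere settles it at the end.\<close>
  let ?c = "ennreal (2 / omega DIM('a)) * of_nat DIM('a)"
  let ?cone = "\<lambda>A. {x \<in> ball 0 1 - {0}. sgn x \<in> A}"
  have space: "halfsphere e \<in> sets (halfsphere_uniform e)"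
    using sets.top[of "halfsphere_uniform e"] by simp
  \<comment> \<open>The lune may contain points with \<open>x \<bullet> e = 0\<close>, which the
    open wedge omits; the hyperplane absorbs them and has volume zero.\<close>
  have "?cone ?L \<subseteq> wedge e ?v \<union> {x. e \<bullet> x = 0}"
    by (auto simp: wedge_def halfsphere_def sgn_div_norm zero_le_mult_iff mult_less_0_iff inner_commute field_simps)
  then have "emeasure lborel (?cone ?L) \<le> emeasure lborel (wedge e ?v \<union> {x. e \<bullet> x = 0})"
    using borel_open[OF open_wedge[of e ?v]]
    by (intro emeasure_mono) (auto intro!: sets.Un borel_closed closed_hyperplane)
  also have "\<dots> = emeasure lborel (wedge e ?v)"
  proof (intro emeasure_Un_null_set)
    have "e \<noteq> 0" using ez by auto
    then have "negligible {x. e \<bullet> x = 0}" by (intro negligible_hyperplane) simp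
    moreover have "{x. e \<bullet> x = 0} \<in> sets borel" by (intro borel_closed closed_hyperplane)
    ultimately show "{x. e \<bullet> x = 0} \<in> null_sets lborel"
      by (simp add: negligible_iff_null_sets null_sets_completion_iff)
  qed (use borel_open[OF open_wedge[of e ?v]] in simp)
  finally have 1: "emeasure lborel (?cone ?L) \<le> emeasure lborel (wedge e ?v)" .
  have "2 ^ k * emeasure (halfsphere_uniform e) ?L = ?c * (2 ^ k * emeasure lborel (?cone ?L))"
    by (simp add: emeasure_halfsphere_uniform[OF sets_lune] mult_ac)
  also have "\<dots> \<le> ?c * (2 ^ k * emeasure lborel (wedge e ?v))"
    using 1 by (intro mult_left_mono) auto
  also have "\<dots> \<le> ?c * emeasure lborel (wedge e (- e))"
    using emeasure_wedge_tilt_dyadic[OF ez] by (intro mult_left_mono) auto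
  also have "\<dots> \<le> ?c * emeasure lborel (?cone (halfsphere e))"
  proof (intro mult_left_mono emeasure_mono)
    show "wedge e (- e) \<subseteq> ?cone (halfsphere e)"
    proof
      fix x assume x: "x \<in> wedge e (- e)"
      then have "x \<noteq> 0" by (auto simp: wedge_def)
      then show "x \<in> ?cone (halfsphere e)"
        using x by (simp add: wedge_def halfsphere_def norm_sgn, simp add: sgn_div_norm)
    qed
    have "halfsphere e \<in> sets borel" using closed_halfsphere by (rule borel_closed)
    then show "?cone (halfsphere e) \<in> sets lborel" by (simp add: borel_Collect_sgn)
  qed auto
  also have "\<dots> = 1"
    using emeasure_halfsphere_uniform[OF space] emeasure_space_1 by simp
  finally have "2 ^ k * emeasure (halfsphere_uniform e) ?L \<le> 1" .
  then have "ennreal (2 ^ k * measure (halfsphere_uniform e) ?L) \<le> 1"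
    by (simp add: emeasure_eq_measure ennreal_mult ennreal_power[symmetric])
  then have "2 ^ k * measure (halfsphere_uniform e) ?L \<le> 1"
    by (simp add: ennreal_le_1)
  then show ?thesis by (simp add: field_simps)
qed

subsection \<open>Spherical Hausdorff distance\<close>

text \<open>Infima and suprema of reals are meaningful only for bounded sets; the bounds 0 and
  \<open>pi\<close> provide this in all later estimates.\<close>

lemma sph_dist_bounds:
  assumes "norm x = 1" "norm y = 1" shows "0 \<le> sph_dist x y" "sph_dist x y \<le> pi"
proof -
  have "\<bar>x \<bullet> y\<bar> \<le> 1" using Cauchy_Schwarz_ineq2[of x y] assms by simp
  then show "0 \<le> sph_dist x y" "sph_dist x y \<le> pi"
    unfolding sph_dist_def by (auto intro: arccos_lbound arccos_ubound)
qed

lemma bdd_below_sph_dist: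
  assumes "norm x = 1" "K \<subseteq> sphere 0 1"
  shows "bdd_below (sph_dist x ` K)"
  using assms sph_dist_bounds(1)[of x] by (intro bdd_belowI2[where m = 0]) auto

lemma INF_sph_dist_le_pi:
  assumes "norm x = 1" "K \<subseteq> sphere 0 1" "K \<noteq> {}"
  shows "(INF y\<in>K. sph_dist x y) \<le> pi"
proof -
  obtain y where "y \<in> K" using assms by blast
  then have "(INF y\<in>K. sph_dist x y) \<le> sph_dist x y"
    using assms by (intro cINF_lower bdd_below_sph_dist) auto
  also have "\<dots> \<le> pi" using \<open>y \<in> K\<close> assms by (intro sph_dist_bounds) auto
  finally show ?thesis .
qed

lemma INF_sph_dist_le_sph_hausdorff:
  assumes "K \<subseteq> sphere 0 1" "K \<noteq> {}" "M \<subseteq> sphere 0 1" "x \<in> M"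
  shows "(INF y\<in>K. sph_dist x y) \<le> sph_hausdorff K M"
proof -
  have "bdd_above ((\<lambda>x. INF y\<in>K. sph_dist x y) ` M)"
    using assms by (intro bdd_aboveI2[where M = pi] INF_sph_dist_le_pi) auto
  then show ?thesis
    unfolding sph_hausdorff_def using assms(4)
    by (intro max.coboundedI2 cSUP_upper)
qed

text \<open>Each point of \<open>K\<close> has distance 0 to \<open>M\<close>, so one side of the
  maximum vanishes and the other is nonnegative.\<close>

lemma sph_hausdorff_subset:
  assumes "K \<subseteq> M" "K \<noteq> {}" "M \<subseteq> sphere 0 1"
  shows "sph_hausdorff K M = (SUP x\<in>M. INF y\<in>K. sph_dist x y)"
proof -
  have "(INF y\<in>M. sph_dist x y) = 0" if "x \<in> K" for x
  proof (rule antisym)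
    have x: "x \<in> M" "norm x = 1" using that assms by auto
    have "(INF y\<in>M. sph_dist x y) \<le> sph_dist x x"
      using x assms by (intro cINF_lower bdd_below_sph_dist) auto
    then show "(INF y\<in>M. sph_dist x y) \<le> 0"
      using x by (simp add: sph_dist_def dot_square_norm)
    show "0 \<le> (INF y\<in>M. sph_dist x y)"
      using x assms(3) by (intro cINF_greatest sph_dist_bounds) auto
  qed
  then have 0: "(SUP x\<in>K. INF y\<in>M. sph_dist x y) = 0"
    using assms by simp
  obtain x where x: "x \<in> M" using assms by blast
  have "0 \<le> (INF y\<in>K. sph_dist x y)"
    using x assms by (intro cINF_greatest sph_dist_bounds) auto
  also have "\<dots> \<le> (SUP x\<in>M. INF y\<in>K. sph_dist x y)"
    using assms x
    by (intro cSUP_upper bdd_aboveI2[where M = pi] INF_sph_dist_le_pi) auto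
  finally show ?thesis by (simp add: sph_hausdorff_def 0)
qed

text \<open>Coefficients are attached to indices instead of vectors, so that they range over a set
  independent of the points, even when points coincide. One inclusion picks a preimage of each
  vector and pads with zeros, the other sums coefficients over fibres.\<close>

lemma pos_hull_image:
  assumes I: "finite I"
  shows "pos_hull (a ` I) = {\<Sum>i\<in>I. c i *\<^sub>R a i | c. \<forall>i\<in>I. c i \<ge> (0::real)}"
proof (intro equalityI subsetI)
  fix y assume "y \<in> pos_hull (a ` I)"
  then obtain F c where F: "finite F" "F \<subseteq> a ` I" "\<forall>x\<in>F. c x \<ge> (0::real)"
    and y: "y = (\<Sum>x\<in>F. c x *\<^sub>R x)"
    unfolding pos_hull_def by blast
  let ?g = "inv_into I a"
  have inj: "inj_on ?g F" using F(2) by (rule inj_on_inv_into)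
  have gI: "?g ` F \<subseteq> I" using F(2) by (auto intro: inv_into_into)
  have "y = (\<Sum>i\<in>?g ` F. c (a i) *\<^sub>R a i)"
    unfolding y sum.reindex[OF inj] using F(2)
    by (intro sum.cong) (auto simp: f_inv_into_f subset_iff)
  also have "\<dots> = (\<Sum>i\<in>I. (if i \<in> ?g ` F then c (a i) else 0) *\<^sub>R a i)"
    using gI I by (intro sum.mono_neutral_cong_left) auto
  finally have "y = (\<Sum>i\<in>I. (if i \<in> ?g ` F then c (a i) else 0) *\<^sub>R a i)" .
  moreover have "\<forall>i\<in>I. (if i \<in> ?g ` F then c (a i) else 0) \<ge> 0"
    using F(2,3) by (auto simp: f_inv_into_f subset_iff)
  ultimately show "y \<in> {\<Sum>i\<in>I. c i *\<^sub>R a i | c. \<forall>i\<in>I. c i \<ge> (0::real)}"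
    by (intro CollectI exI[of _ "\<lambda>i. if i \<in> ?g ` F then c (a i) else 0"] conjI)
next
  fix y assume "y \<in> {\<Sum>i\<in>I. c i *\<^sub>R a i | c. \<forall>i\<in>I. c i \<ge> (0::real)}"
  then obtain c where c: "\<forall>i\<in>I. c i \<ge> (0::real)" and y: "y = (\<Sum>i\<in>I. c i *\<^sub>R a i)" by blast
  have "y = (\<Sum>x\<in>a ` I. \<Sum>i\<in>{i\<in>I. a i = x}. c i *\<^sub>R a i)"
    unfolding y using I by (rule sum.image_gen)
  also have "\<dots> = (\<Sum>x\<in>a ` I. (\<Sum>i\<in>{i\<in>I. a i = x}. c i) *\<^sub>R x)"
    by (intro sum.cong) (auto simp: scaleR_sum_left)
  finally have "y = (\<Sum>x\<in>a ` I. (\<Sum>i\<in>{i\<in>I. a i = x}. c i) *\<^sub>R x)" .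
  moreover have "\<forall>x\<in>a ` I. (\<Sum>i\<in>{i\<in>I. a i = x}. c i) \<ge> 0"
    using c by (auto intro: sum_nonneg)
  ultimately show "y \<in> pos_hull (a ` I)"
    unfolding pos_hull_def using I
    by (intro CollectI exI[of _ "a ` I"] exI[of _ "\<lambda>x. \<Sum>i\<in>{i\<in>I. a i = x}. c i"]) auto
qed

lemma inner_pos_hull_nonneg:
  assumes "y \<in> pos_hull A" "\<And>a. a \<in> A \<Longrightarrow> a \<bullet> v \<ge> 0"
  shows "y \<bullet> v \<ge> 0"
  using assms unfolding pos_hull_def
  by (auto simp: inner_sum_left subset_iff intro!: sum_nonneg)

lemma subset_sph_conv:
  assumes "A \<subseteq> sphere 0 1" shows "A \<subseteq> sph_conv A"
proof
  fix x assume "x \<in> A"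
  then have "x \<in> pos_hull A"
    unfolding pos_hull_def by (intro CollectI exI[of _ "{x}"] exI[of _ "\<lambda>_. 1"]) auto
  then show "x \<in> sph_conv A" using \<open>x \<in> A\<close> assms by (auto simp: sph_conv_def)
qed

lemma sph_conv_subset_halfsphere:
  "A \<subseteq> halfsphere e \<Longrightarrow> sph_conv A \<subseteq> halfsphere e"
  by (auto simp: sph_conv_def halfsphere_def subset_iff intro: inner_pos_hull_nonneg)

lemma sph_hausdorff_ge_tilt:
  fixes e z :: "'a::euclidean_space"
  assumes ez: "norm e = 1" "norm z = 1" "e \<bullet> z = 0"
    and t: "0 \<le> t" "t \<le> pi / 2"
    and A: "A \<subseteq> halfsphere e" "A \<noteq> {}" "\<And>a. a \<in> A \<Longrightarrow> a \<bullet> tilt e z t \<ge> 0"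
  shows "t \<le> sph_hausdorff (sph_conv A) (halfsphere e)"
proof -
  have z: "z \<in> halfsphere e" using ez by (simp add: halfsphere_def inner_commute)
  have As: "A \<subseteq> sphere 0 1" using A(1) by (auto simp: halfsphere_def)
  have ne: "sph_conv A \<noteq> {}" using subset_sph_conv[OF As] A(2) by blast
  have "t \<le> sph_dist z y" if y: "y \<in> sph_conv A" for y
  proof -
    have ny: "norm y = 1" and yv: "y \<bullet> tilt e z t \<ge> 0"
      using y A(3) by (auto simp: sph_conv_def intro: inner_pos_hull_nonneg)
    \<comment> \<open>\<open>?q\<close> and \<open>tilt e z t\<close> are orthonormal, and
      \<open>z\<close> has coordinates \<open>cos t\<close> and \<open>- sin t\<close> with respect
      to them. Hence \<open>y \<bullet> ?q \<le> 1\<close> and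
      \<open>y \<bullet> tilt e z t \<ge> 0\<close> give
      \<open>y \<bullet> z \<le> cos t\<close>.\<close>
    let ?q = "cos t *\<^sub>R z + sin t *\<^sub>R e"
    have "e \<bullet> e = 1" "z \<bullet> z = 1" using ez by (simp_all add: dot_square_norm)
    then have "?q \<bullet> ?q = (cos t)\<^sup>2 + (sin t)\<^sup>2"
      using ez(3) by (simp add: inner_add_left inner_add_right inner_commute[of z e] power2_eq_square)
    then have nq: "norm ?q = 1" by (simp add: norm_eq_sqrt_inner)
    have zq: "z = cos t *\<^sub>R ?q - sin t *\<^sub>R tilt e z t"
    proof -
      have "cos t *\<^sub>R ?q - sin t *\<^sub>R tilt e z t = ((cos t)\<^sup>2 + (sin t)\<^sup>2) *\<^sub>R z"
        unfolding scaleR_left_distrib by (simp add: tilt_def algebra_simps power2_eq_square)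
      then show ?thesis by simp
    qed
    have cs: "cos t \<ge> 0" "sin t \<ge> 0"
      using t by (auto intro!: cos_ge_zero sin_ge_zero)
    have "y \<bullet> z = cos t * (y \<bullet> ?q) - sin t * (y \<bullet> tilt e z t)"
      by (subst zq) (simp add: inner_diff_right)
    also have "\<dots> \<le> cos t * 1 - 0"
      using norm_cauchy_schwarz[of y ?q] ny nq cs yv
      by (intro diff_mono mult_left_mono) auto
    finally have le: "z \<bullet> y \<le> cos t" by (simp add: inner_commute)
    have "\<bar>z \<bullet> y\<bar> \<le> 1" using Cauchy_Schwarz_ineq2[of z y] ny ez by simp
    then have "arccos (cos t) \<le> arccos (z \<bullet> y)"
      using le by (intro arccos_le_arccos) auto
    then show ?thesis using t by (simp add: sph_dist_def arccos_cos)
  qed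
  then have "t \<le> (INF y\<in>sph_conv A. sph_dist z y)"
    using ne by (intro cINF_greatest)
  also have "\<dots> \<le> sph_hausdorff (sph_conv A) (halfsphere e)"
    using ne z by (intro INF_sph_dist_le_sph_hausdorff) (auto simp: sph_conv_def halfsphere_def)
  finally show ?thesis .
qed

subsection \<open>Measurability\<close>

lemma sph_dist_commute: "sph_dist x y = sph_dist y x"
  by (simp add: sph_dist_def inner_commute)

text \<open>Since \<open>arccos\<close> is not Lipschitz at the endpoints, compactness of the
  interval supplies a \<open>\<delta>\<close> that is independent of \<open>y\<close>.\<close>

lemma sph_dist_uniformly_continuous:
  assumes "0 < \<epsilon>"
  obtains \<delta> where "0 < \<delta>"
    "\<And>x x' y :: 'a::euclidean_space. \<lbrakk>norm x = 1; norm x' = 1; norm y = 1; dist x x' < \<delta>\<rbrakk>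
       \<Longrightarrow> \<bar>sph_dist x y - sph_dist x' y\<bar> < \<epsilon>"
proof -
  have "uniformly_continuous_on {-1..1} arccos"
    by (intro compact_uniformly_continuous continuous_on_arccos') auto
  then obtain \<delta> where \<delta>: "\<delta> > 0"
    "\<And>u u'. \<lbrakk>u \<in> {-1..1}; u' \<in> {-1..1}; dist u' u < \<delta>\<rbrakk> \<Longrightarrow> dist (arccos u') (arccos u) < \<epsilon>"
    unfolding uniformly_continuous_on_def using assms by metis
  show thesis
  proof (rule that[OF \<delta>(1)])
    fix x x' y :: 'a
    assume n: "norm x = 1" "norm x' = 1" "norm y = 1" "dist x x' < \<delta>"
    have "\<bar>x \<bullet> y\<bar> \<le> 1" "\<bar>x' \<bullet> y\<bar> \<le> 1"
      using Cauchy_Schwarz_ineq2[of x y] Cauchy_Schwarz_ineq2[of x' y] n by auto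
    moreover have "dist (x \<bullet> y) (x' \<bullet> y) < \<delta>"
      using Cauchy_Schwarz_ineq2[of "x - x'" y] n by (simp add: dist_norm inner_diff_left)
    ultimately show "\<bar>sph_dist x y - sph_dist x' y\<bar> < \<epsilon>"
      using \<delta>(2)[of "x' \<bullet> y" "x \<bullet> y"] by (simp add: sph_dist_def dist_real_def abs_le_iff)
  qed
qed

text \<open>
  Only countably many quantifiers remain on the right-hand side when \<open>K0\<close> and \<open>M0\<close> are countable.
\<close>

lemma sph_hausdorff_less_iff:
  fixes K M :: "'a::euclidean_space set"
  assumes K: "K \<subseteq> M" "K \<noteq> {}" and M: "M \<subseteq> sphere 0 1"
    and M0: "M0 \<subseteq> M" "M \<subseteq> closure M0" and K0: "K0 \<subseteq> K" "K \<subseteq> closure K0"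
  shows "sph_hausdorff K M < t \<longleftrightarrow> (\<exists>s\<in>\<rat>. s < t \<and> (\<forall>x\<in>M0. \<exists>y\<in>K0. sph_dist x y < s))"
proof
  assume less: "sph_hausdorff K M < t"
  obtain s where s: "s \<in> \<rat>" "sph_hausdorff K M < s" "s < t"
    using Rats_dense_in_real[OF less] by blast
  \<comment> \<open>The strict gap \<open>s - sph_dist x y\<close> leaves room to replace
    \<open>y\<close> by a nearby point of the dense set \<open>K0\<close>.\<close>
  have "\<exists>y\<in>K0. sph_dist x y < s" if x: "x \<in> M0" for x
  proof -
    have nx: "norm x = 1" "x \<in> M" using x M M0 by auto
    have "(INF y\<in>K. sph_dist x y) \<le> sph_hausdorff K M"
      using K M nx by (intro INF_sph_dist_le_sph_hausdorff) auto
    then have "(INF y\<in>K. sph_dist x y) < s" using s by simp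
    then obtain y where y: "y \<in> K" "sph_dist x y < s"
      using cINF_less_iff[of K "sph_dist x" s] K M nx bdd_below_sph_dist[of x K] by auto
    then have "s - sph_dist x y > 0" by simp
    then obtain \<delta> where \<delta>: "0 < \<delta>"
      "\<And>z z' y' :: 'a. \<lbrakk>norm z = 1; norm z' = 1; norm y' = 1; dist z z' < \<delta>\<rbrakk>
         \<Longrightarrow> \<bar>sph_dist z y' - sph_dist z' y'\<bar> < s - sph_dist x y"
      using sph_dist_uniformly_continuous by blast
    obtain y0 where y0: "y0 \<in> K0" "dist y0 y < \<delta>"
      using y(1) K0(2) \<delta>(1) closure_approachable by blast
    have "norm y = 1" "norm y0 = 1" using y(1) y0(1) K(1) K0(1) M by (auto simp: subset_iff)
    then have "\<bar>sph_dist y0 x - sph_dist y x\<bar> < s - sph_dist x y"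
      using \<delta>(2) y0 nx by blast
    then show ?thesis using y0 by (intro bexI[of _ y0]) (auto simp: sph_dist_commute)
  qed
  then show "\<exists>s\<in>\<rat>. s < t \<and> (\<forall>x\<in>M0. \<exists>y\<in>K0. sph_dist x y < s)" using s by blast
next
  assume "\<exists>s\<in>\<rat>. s < t \<and> (\<forall>x\<in>M0. \<exists>y\<in>K0. sph_dist x y < s)"
  then obtain s where s: "s < t" "\<And>x. x \<in> M0 \<Longrightarrow> \<exists>y\<in>K0. sph_dist x y < s" by blast
  have "sph_hausdorff K M = (SUP x\<in>M. INF y\<in>K. sph_dist x y)"
    using K M by (intro sph_hausdorff_subset) auto
  also have "\<dots> \<le> s"
  proof (intro cSUP_least)
    show "M \<noteq> {}" using K by blast
    fix x assume x: "x \<in> M"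
    then have nx: "norm x = 1" using M by auto
    show "(INF y\<in>K. sph_dist x y) \<le> s"
    \<comment> \<open>Approximating \<open>x\<close> from \<open>M0\<close> costs an arbitrary
      \<open>\<epsilon>\<close>, so only a weak bound by \<open>s\<close> survives;
      \<open>s < t\<close> restores strictness.\<close>
    proof (rule field_le_epsilon)
      fix \<epsilon> :: real assume "\<epsilon> > 0"
      then obtain \<delta> where \<delta>: "0 < \<delta>"
        "\<And>z z' y' :: 'a. \<lbrakk>norm z = 1; norm z' = 1; norm y' = 1; dist z z' < \<delta>\<rbrakk>
           \<Longrightarrow> \<bar>sph_dist z y' - sph_dist z' y'\<bar> < \<epsilon>"
        using sph_dist_uniformly_continuous by blast
      obtain x0 where x0: "x0 \<in> M0" "dist x0 x < \<delta>"
        using x M0(2) \<delta>(1) closure_approachable by blast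
      obtain y where y: "y \<in> K0" "sph_dist x0 y < s" using s(2) x0 by blast
      have n: "norm x0 = 1" "norm y = 1" using x0(1) y(1) M M0(1) K(1) K0(1) by (auto simp: subset_iff)
      have "(INF y\<in>K. sph_dist x y) \<le> sph_dist x y"
        using y K0 K M nx by (intro cINF_lower bdd_below_sph_dist) auto
      also have "\<dots> \<le> s + \<epsilon>"
        using \<delta>(2)[OF n(1) nx n(2) x0(2)] y(2) by simp
      finally show "(INF y\<in>K. sph_dist x y) \<le> s + \<epsilon>" .
    qed
  qed
  finally show "sph_hausdorff K M < t" using s by simp
qed

text \<open>Extensionality pins the values outside \<open>I\<close>, so that a finite
  \<open>I\<close> gives a countable set.\<close>

definition rat_coeffs :: "'i set \<Rightarrow> ('i \<Rightarrow> real) set" where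
  "rat_coeffs I = (\<Pi>\<^sub>E i\<in>I. \<rat> \<inter> {0..})"

lemma countable_rat_coeffs: "finite I \<Longrightarrow> countable (rat_coeffs I)"
  unfolding rat_coeffs_def by (intro countable_PiE) (auto simp: countable_rat)

text \<open>A rational combination is seldom a unit vector, hence the radial projection; a vanishing
  sum is excluded because \<open>sgn 0 = 0\<close> is off the sphere.\<close>

definition rat_conv :: "'i set \<Rightarrow> ('i \<Rightarrow> 'a::euclidean_space) \<Rightarrow> 'a set" where
  "rat_conv I a = {sgn (\<Sum>i\<in>I. q i *\<^sub>R a i) | q. q \<in> rat_coeffs I \<and> (\<Sum>i\<in>I. q i *\<^sub>R a i) \<noteq> 0}"

lemma rat_conv_subset:
  assumes "finite I" shows "rat_conv I a \<subseteq> sph_conv (a ` I)"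
proof
  fix y assume "y \<in> rat_conv I a"
  then obtain q where q: "q \<in> rat_coeffs I" "(\<Sum>i\<in>I. q i *\<^sub>R a i) \<noteq> 0"
    and y: "y = sgn (\<Sum>i\<in>I. q i *\<^sub>R a i)"
    by (auto simp: rat_conv_def)
  let ?r = "inverse (norm (\<Sum>i\<in>I. q i *\<^sub>R a i))"
  have "y = (\<Sum>i\<in>I. (?r * q i) *\<^sub>R a i)"
    unfolding y sgn_div_norm scaleR_sum_right by simp
  moreover have "\<forall>i\<in>I. ?r * q i \<ge> 0"
    using q(1) by (auto simp: rat_coeffs_def PiE_iff intro!: mult_nonneg_nonneg)
  ultimately have "y \<in> pos_hull (a ` I)"
    unfolding pos_hull_image[OF assms] by (intro CollectI exI[of _ "\<lambda>i. ?r * q i"] conjI)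
  moreover have "norm y = 1" using y q(2) by (simp add: norm_sgn)
  ultimately show "y \<in> sph_conv (a ` I)" by (simp add: sph_conv_def)
qed

text \<open>Nonnegative coefficients are increased slightly to rational ones, and \<open>sgn\<close>
  is continuous at the nonzero point \<open>y\<close> and fixes it.\<close>

lemma sph_conv_subset_closure_rat_conv:
  fixes a :: "'i \<Rightarrow> 'a::euclidean_space"
  assumes I: "finite I" and a: "a ` I \<subseteq> sphere 0 1"
  shows "sph_conv (a ` I) \<subseteq> closure (rat_conv I a)"
proof
  fix y assume y: "y \<in> sph_conv (a ` I)"
  then obtain c where c: "\<forall>i\<in>I. c i \<ge> (0::real)" and yc: "y = (\<Sum>i\<in>I. c i *\<^sub>R a i)"
    by (auto simp: sph_conv_def pos_hull_image[OF I])
  have ny: "norm y = 1" using y by (simp add: sph_conv_def)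
  then have y0: "y \<noteq> 0" by auto
  have "isCont (sgn :: 'a \<Rightarrow> 'a) y"
    unfolding sgn_div_norm using y0 by (intro continuous_intros) auto
  show "y \<in> closure (rat_conv I a)"
    unfolding closure_approachable
  proof (intro allI impI)
    fix \<epsilon> :: real assume "\<epsilon> > 0"
    then obtain \<delta> where \<delta>: "\<delta> > 0" "\<And>u. dist u y < \<delta> \<Longrightarrow> dist (sgn u) (sgn y) < \<epsilon>"
      using \<open>isCont sgn y\<close> unfolding continuous_at_eps_delta by blast
    \<comment> \<open>The budget is shared among \<open>card I\<close> summands; the extra 1 makes
      the total strict and avoids division by zero. The cap at 1 keeps the perturbed sum away from
      0, as \<open>y\<close> has norm 1.\<close>
    define \<eta> where "\<eta> = min \<delta> 1 / (real (card I) + 1)"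
    have \<eta>: "\<eta> > 0" using \<delta>(1) by (simp add: \<eta>_def)
    have "\<exists>q. q \<in> \<rat> \<and> c i < q \<and> q < c i + \<eta>" for i
      using Rats_dense_in_real[of "c i" "c i + \<eta>"] \<eta> by auto
    then obtain q where q: "\<And>i. q i \<in> \<rat>" "\<And>i. c i < q i" "\<And>i. q i < c i + \<eta>" by metis
    let ?q = "restrict q I"
    have q_in: "?q \<in> rat_coeffs I"
      using q(1,2) c by (force simp: rat_coeffs_def intro: order_trans less_imp_le)
    let ?u = "\<Sum>i\<in>I. ?q i *\<^sub>R a i"
    have "dist ?u y = norm (\<Sum>i\<in>I. (q i - c i) *\<^sub>R a i)"
      by (simp add: dist_norm yc scaleR_diff_left sum_subtractf)
    also have "\<dots> \<le> (\<Sum>i\<in>I. norm ((q i - c i) *\<^sub>R a i))" by (rule norm_sum)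
    also have "\<dots> \<le> (\<Sum>i\<in>I. \<eta>)"
    proof (intro sum_mono)
      fix i assume "i \<in> I"
      then have "norm (a i) = 1" using a by auto
      then show "norm ((q i - c i) *\<^sub>R a i) \<le> \<eta>" using q(2,3)[of i] by simp
    qed
    also have "\<dots> < (real (card I) + 1) * \<eta>" using \<eta> by simp
    also have "\<dots> = min \<delta> 1" by (simp add: \<eta>_def)
    finally have du: "dist ?u y < \<delta>" "dist ?u y < 1" by auto
    then have "?u \<noteq> 0" using ny by auto
    then have "sgn ?u \<in> rat_conv I a" using q_in unfolding rat_conv_def by blast
    moreover have "dist (sgn ?u) y < \<epsilon>"
      using \<delta>(2)[OF du(1)] ny by (simp add: sgn_div_norm)
    ultimately show "\<exists>v\<in>rat_conv I a. dist v y < \<epsilon>" by blast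
  qed
qed

lemma borel_measurable_sph_dist_sgn:
  fixes f :: "'b \<Rightarrow> 'a::euclidean_space"
  assumes f: "f \<in> borel_measurable N" and x: "norm x = 1"
  shows "(\<lambda>w. sph_dist x (sgn (f w))) \<in> borel_measurable N"
proof -
  \<comment> \<open>Clamping extends \<open>arccos\<close> continuously to all reals; by
    Cauchy-Schwarz it leaves the inner products unchanged.\<close>
  have "continuous_on UNIV (\<lambda>u::real. arccos (max (-1) (min 1 u)))"
    by (intro continuous_on_arccos continuous_intros) auto
  moreover have "(\<lambda>w. x \<bullet> sgn (f w)) \<in> borel_measurable N"
    unfolding sgn_div_norm using f by measurable
  ultimately have "(\<lambda>w. arccos (max (-1) (min 1 (x \<bullet> sgn (f w))))) \<in> borel_measurable N"
    using borel_measurable_continuous_on by blast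
  moreover have "max (-1) (min 1 (x \<bullet> sgn (f w))) = x \<bullet> sgn (f w)" for w
  proof -
    have "\<bar>x \<bullet> sgn (f w)\<bar> \<le> norm x * norm (sgn (f w))" by (rule Cauchy_Schwarz_ineq2)
    also have "\<dots> \<le> 1" using x by (simp add: norm_sgn)
    finally show ?thesis by auto
  qed
  ultimately show ?thesis by (simp add: sph_dist_def)
qed

lemma sets_sph_hausdorff_ge:
  fixes e :: "'a::euclidean_space"
  assumes I: "finite I" "I \<noteq> {}"
  shows "{a \<in> space (PiM I (\<lambda>_. halfsphere_uniform e)).
    t \<le> sph_hausdorff (sph_conv (a ` I)) (halfsphere e)} \<in> sets (PiM I (\<lambda>_. halfsphere_uniform e))"
proof -
  let ?N = "PiM I (\<lambda>_. halfsphere_uniform e)"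
  obtain H0 where H0: "countable H0" "H0 \<subseteq> halfsphere e" "halfsphere e \<subseteq> closure H0"
    using separable[of "halfsphere e"] by blast
  let ?S = "\<lambda>q a. \<Sum>i\<in>I. q i *\<^sub>R a i"
  \<comment> \<open>Quantifying over coefficients instead of hull points keeps the countable index
    sets independent of the sample \<open>a\<close>; each remaining condition is measurable in
    \<open>a\<close>.\<close>
  let ?P = "\<lambda>a. \<exists>s\<in>\<rat>. s < t \<and> (\<forall>x\<in>H0. \<exists>q\<in>rat_coeffs I. ?S q a \<noteq> 0 \<and> sph_dist x (sgn (?S q a)) < s)"
  have eq: "t \<le> sph_hausdorff (sph_conv (a ` I)) (halfsphere e) \<longleftrightarrow> \<not> ?P a" if "a \<in> space ?N" for a
  proof -
    have aI: "a ` I \<subseteq> halfsphere e" using that by (auto simp: space_PiM)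
    then have aS: "a ` I \<subseteq> sphere 0 1" using sphere_halfsphere by blast
    have ne: "sph_conv (a ` I) \<noteq> {}" using subset_sph_conv[OF aS] I(2) by blast
    have "sph_hausdorff (sph_conv (a ` I)) (halfsphere e) < t \<longleftrightarrow>
        (\<exists>s\<in>\<rat>. s < t \<and> (\<forall>x\<in>H0. \<exists>y\<in>rat_conv I a. sph_dist x y < s))"
      using H0 ne sph_conv_subset_halfsphere[OF aI] sphere_halfsphere[of e]
        rat_conv_subset[OF I(1)] sph_conv_subset_closure_rat_conv[OF I(1) aS]
      by (intro sph_hausdorff_less_iff)
    also have "\<dots> \<longleftrightarrow> ?P a" unfolding rat_conv_def by blast
    finally show ?thesis by (simp add: not_less[symmetric])
  qed
  have comp: "(\<lambda>a. a i) \<in> borel_measurable ?N" if "i \<in> I" for i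
  proof -
    have "(\<lambda>x. x) \<in> halfsphere_uniform e \<rightarrow>\<^sub>M borel"
      by (subst measurable_cong_sets[OF sets_halfsphere_uniform refl])
         (rule measurable_restrict_space1[OF measurable_ident[unfolded id_def]])
    then show ?thesis
      by (rule measurable_compose[OF measurable_component_singleton[OF that]])
  qed
  have S[measurable]: "(\<lambda>a. ?S q a) \<in> borel_measurable ?N" for q
    using comp by (intro borel_measurable_sum borel_measurable_scaleR) auto
  have [measurable]: "(\<lambda>a. sph_dist x (sgn (?S q a))) \<in> borel_measurable ?N" if "x \<in> H0" for q x
    using that H0(2) by (intro borel_measurable_sph_dist_sgn S) (auto simp: halfsphere_def)
  have "{a \<in> space ?N. ?P a} \<in> sets ?N"
    using H0(1) countable_rat_coeffs[OF I(1)] countable_rat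
    by (intro sets.sets_Collect_countable_Ex' sets.sets_Collect_countable_All' sets.sets_Collect_conj)
       measurable
  then have "{a \<in> space ?N. \<not> ?P a} \<in> sets ?N"
    by (rule sets.sets_Collect_neg)
  also have "{a \<in> space ?N. \<not> ?P a} = {a \<in> space ?N. t \<le> sph_hausdorff (sph_conv (a ` I)) (halfsphere e)}"
    using eq by blast
  finally show ?thesis .
qed

subsection \<open>Estimates\<close>

text \<open>The recursion of \<open>Gamma\<close> raises \<open>d\<close> by two, hence the two base
  cases: equality at \<open>d = 2\<close>, and \<open>pi / 2 \<le> 2\<close> at
  \<open>d = 3\<close>. The two recursion factors \<open>k / 2\<close> and
  \<open>(k + 1) / 2\<close> compare the right way.\<close>

lemma Gamma_half_ratio_le:
  assumes "d \<ge> 2"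
  shows "sqrt pi * Gamma (real d / 2) \<le> 2 * Gamma (real (d + 1) / 2)"
  using assms
proof (induction d rule: less_induct)
  case (less d)
  have G: "Gamma (x + 1) = x * Gamma x" if "x > 0" for x :: real
    using Gamma_plus1[of x] nonpos_Ints_nonpos[of x] that by force
  have G3: "Gamma (3 / 2 :: real) = 1 / 2 * sqrt pi"
    using G[of "1 / 2"] by (simp add: Gamma_one_half_real)
  consider "d = 2" | "d = 3" | "d \<ge> 4" using less.prems by linarith
  then show ?case
  proof cases
    case 1
    then show ?thesis using G3 by simp
  next
    case 2
    have "sqrt pi * Gamma (3 / 2 :: real) = pi / 2"
      by (simp add: G3)
    moreover have "Gamma (2 :: real) = 1" using Gamma_fact[of 1, where 'a = real] by simp
    ultimately show ?thesis using 2 pi_less_4 by simp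
  next
    case 3
    define k where "k = d - 2"
    have k: "d = k + 2" "k \<ge> 2" using 3 by (auto simp: k_def)
    have g: "Gamma (real d / 2) = real k / 2 * Gamma (real k / 2)"
      using G[of "real k / 2"] k by (simp add: field_simps)
    have g': "Gamma (real (d + 1) / 2) = real (k + 1) / 2 * Gamma (real (k + 1) / 2)"
      using G[of "real (k + 1) / 2"] k by (simp add: field_simps)
    have pos: "Gamma (real (k + 1) / 2) > 0" by (intro Gamma_real_pos) simp
    have "sqrt pi * Gamma (real d / 2) = real k / 2 * (sqrt pi * Gamma (real k / 2))"
      unfolding g by simp
    also have "\<dots> \<le> real k / 2 * (2 * Gamma (real (k + 1) / 2))"
      using less.IH[of k] k by (intro mult_left_mono) auto
    also have "\<dots> \<le> real (k + 1) / 2 * (2 * Gamma (real (k + 1) / 2))"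
      using pos by (intro mult_right_mono) auto
    also have "\<dots> = 2 * Gamma (real (d + 1) / 2)" unfolding g' by simp
    finally show ?thesis .
  qed
qed

lemma omega_pos: "k > 0 \<Longrightarrow> omega k > 0"
  unfolding omega_def by (intro divide_pos_pos mult_pos_pos Gamma_real_pos) auto

lemma omega_Suc_le:
  assumes "d \<ge> 2" shows "omega (d + 1) \<le> 2 * omega d"
proof -
  let ?p = "pi powr (real d / 2)"
  have pos: "Gamma (real d / 2) > 0" "Gamma (real (d + 1) / 2) > 0"
    using assms by (auto intro!: Gamma_real_pos)
  have "pi powr (real (d + 1) / 2) = ?p * sqrt pi"
    by (simp add: powr_add[symmetric] powr_half_sqrt[symmetric] add_divide_distrib add.commute)
  then have "omega (d + 1) = 2 * ?p * (sqrt pi / Gamma (real (d + 1) / 2))"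
    by (simp add: omega_def)
  also have "sqrt pi / Gamma (real (d + 1) / 2) \<le> 2 / Gamma (real d / 2)"
    using Gamma_half_ratio_le[OF assms] pos by (simp add: field_simps)
  finally show ?thesis by (simp add: omega_def)
qed

lemma dyadic_approx:
  fixes s :: real
  assumes "0 < s" "s \<le> pi / 2"
  obtains k where "s \<le> pi / 2 ^ k" "pi / 2 ^ k < 2 * s" "k \<ge> 1"
proof -
  have "\<exists>m. pi / 2 ^ m < s"
    using real_arch_pow_inv[of "s / pi" "1 / 2"] assms by (auto simp: power_divide field_simps)
  define m where "m = (LEAST m. pi / 2 ^ m < s)"
  have m: "pi / 2 ^ m < s"
    unfolding m_def using \<open>\<exists>m. pi / 2 ^ m < s\<close> by (rule LeastI_ex)
  \<comment> \<open>\<open>s \<le> pi / 2\<close> rules out both values, so the predecessor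
    \<open>k\<close> is at least 1 and its angle is at most \<open>pi / 2\<close>.\<close>
  have "m \<noteq> 0" "m \<noteq> 1"
    using m assms pi_gt_zero by (auto intro: ccontr)
  then obtain k where k: "m = Suc k" "k \<ge> 1" by (cases m) auto
  have "\<not> pi / 2 ^ k < s"
    using not_less_Least[of k "\<lambda>m. pi / 2 ^ m < s"] k by (simp add: m_def)
  moreover have "pi / 2 ^ k < 2 * s" using m k by (simp add: field_simps)
  ultimately show thesis using k(2) that[of k] by simp
qed

text \<open>For \<open>x\<close> in \<open>[0, 1/2]\<close> one has
  \<open>1 - x \<ge> exp (- 2 * x)\<close>, so the power is at least
  \<open>exp (- 2 * c * ln n)\<close>, and \<open>2 * c \<le> 1\<close>. In the theorem this is
  applied with \<open>2 * c / pi\<close> for \<open>c\<close>.\<close>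

lemma one_minus_power_ge_inverse:
  fixes c :: real
  assumes c: "0 \<le> c" "c \<le> 1 / 2" and n: "n \<ge> 1"
  shows "1 / real n \<le> (1 - c * (ln (real n) / real n)) ^ n"
proof -
  define x where "x = c * (ln (real n) / real n)"
  have "ln (real n) \<le> real n" "0 \<le> ln (real n)"
    using n ln_le_minus_one[of "real n"] by auto
  then have "0 \<le> ln (real n) / real n" "ln (real n) / real n \<le> 1"
    using n by auto
  then have x: "0 \<le> x" "x \<le> 1 / 2"
    using c mult_nonneg_nonneg[of c "ln (real n) / real n"] mult_mono[of c "1/2" "ln (real n) / real n" 1] by (auto simp: x_def)
  have "2 * x\<^sup>2 \<le> x"
    using mult_right_mono[OF x(2) x(1)] by (simp add: power2_eq_square)
  then have "- (2 * x) \<le> ln (1 - x)"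
    using ln_one_minus_pos_lower_bound[OF x] by simp
  then have "exp (- (2 * x)) \<le> 1 - x"
    using x by (subst (asm) ln_ge_iff) auto
  then have "exp (- (2 * x)) ^ n \<le> (1 - x) ^ n"
    by (rule power_mono) simp
  moreover have "exp (- (2 * x)) ^ n = exp (- (2 * c * ln (real n)))"
    using n by (simp add: x_def exp_of_nat_mult[symmetric])
  moreover have "2 * c * ln (real n) \<le> 1 * ln (real n)"
    using c n by (intro mult_right_mono) auto
  then have "exp (- ln (real n)) \<le> exp (- (2 * c * ln (real n)))" by simp
  moreover have "exp (- ln (real n)) = 1 / real n"
    using n by (simp add: exp_minus field_simps)
  ultimately show ?thesis unfolding x_def by linarith
qed

section \<open>Independence of the stages and lower bounds for their probabilities\<close>

theorem theorem8p6:
  fixes M :: "'w measure" and e :: "'a::euclidean_space" and d :: nat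
    and X :: "nat \<Rightarrow> nat \<Rightarrow> 'w \<Rightarrow> 'a"
  assumes "d \<ge> 2" and "DIM('a) = d + 1" and "e \<in> sphere 0 1"
    and "prob_space M"
    and "\<And>n i. i \<in> {1..n} \<Longrightarrow> X n i \<in> M \<rightarrow>\<^sub>M halfsphere_uniform e"
    and "\<And>n i. i \<in> {1..n} \<Longrightarrow> distr M (halfsphere_uniform e) (X n i) = halfsphere_uniform e"
    and "\<And>n. prob_space.indep_vars M (\<lambda>_. halfsphere_uniform e) (X n) {1..n}"
    and "prob_space.indep_vars M (\<lambda>n. PiM {1..n} (\<lambda>_. halfsphere_uniform e))
           (\<lambda>n w. \<lambda>i\<in>{1..n}. X n i w) {1..}"
  shows "measure M {w \<in> space M. \<exists>\<^sub>\<infinity>n.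
           sph_hausdorff (sph_conv ((\<lambda>i. X n i w) ` {1..n})) (halfsphere e)
             \<ge> omega (d + 1) / (5 * omega d) * (ln (real n) / real n)} = 1"
proof -
  interpret prob_space M by (rule assms(4))
  let ?H = "halfsphere e" and ?\<mu> = "halfsphere_uniform e"
  note X_meas = assms(5) and X_distr = assms(6)
  define c where "c = omega (d + 1) / (5 * omega d)"
  have c: "0 < c" "c \<le> 2 / 5"
    using omega_Suc_le[OF assms(1)] omega_pos[of d] omega_pos[of "d + 1"] assms(1)
    by (auto simp: c_def field_simps)
  define E where "E n = {w \<in> space M.
    c * (ln (real n) / real n) \<le> sph_hausdorff (sph_conv ((\<lambda>i. X n i w) ` {1..n})) ?H}" for n
  \<comment> \<open>That the halfsphere has total mass one is read off from the distribution of a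
    single point.\<close>
  have "prob_space (distr M ?\<mu> (X 1 1))"
    by (intro prob_space_distr X_meas) simp
  then have \<mu>: "prob_space ?\<mu>" using X_distr[of 1 1] by simp
  then interpret \<mu>: prob_space ?\<mu> .
  have ne: "norm e = 1" using assms(3) by simp
  obtain y where y: "y \<noteq> 0" "orthogonal e y"
    using orthogonal_to_vector_exists[of e] assms(1,2) by auto
  define z where "z = sgn y"
  have ez: "norm e = 1" "norm z = 1" "e \<bullet> z = 0"
    using y ne by (simp_all add: z_def norm_sgn orthogonal_def sgn_div_norm)

  \<comment> \<open>The event at stage \<open>n\<close> is a measurable condition on the sample
    tuple alone, so it inherits the independence of the tuples. Stage 0, with an empty hull, is left
    out.\<close>
  have indep: "indep_events E {1..}"
  proof -
    have "indep_events (\<lambda>n. {w \<in> space M. c * (ln (real n) / real n)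
        \<le> sph_hausdorff (sph_conv ((\<lambda>i\<in>{1..n}. X n i w) ` {1..n})) ?H}) {1..}"
      using assms(8)
      by (rule indep_eventsI_indep_vars[where P = "\<lambda>n a. c * (ln (real n) / real n)
            \<le> sph_hausdorff (sph_conv (a ` {1..n})) ?H"])
         (intro sets_sph_hausdorff_ge, auto)
    then show ?thesis by (simp add: E_def[abs_def] image_restrict_eq)
  qed
  then have E_sets: "E n \<in> events" if "n \<ge> 1" for n
    using that by (auto simp: indep_events_def)

  have lower: "1 / real n \<le> prob (E n)" if n: "n \<ge> 2" for n
  proof -
    define s where "s = c * (ln (real n) / real n)"
    have ln: "0 < ln (real n) / real n" "ln (real n) / real n \<le> 1"
      using n ln_le_minus_one[of "real n"] by auto
    have "s \<le> 2 / 5 * 1"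
      unfolding s_def using c ln by (intro mult_mono) auto
    then have s: "0 < s" "s \<le> pi / 2"
      using mult_pos_pos[OF c(1) ln(1)] pi_gt3 by (auto simp: s_def)
    obtain k where k: "s \<le> pi / 2 ^ k" "pi / 2 ^ k < 2 * s" "k \<ge> 1"
      using dyadic_approx[OF s] .
    define t where "t = pi / 2 ^ k"
    have "(2::real) \<le> 2 ^ k" using power_increasing[OF k(3), of "2::real"] by simp
    then have t: "0 \<le> t" "t \<le> pi / 2"
      using divide_left_mono[of 2 "2 ^ k" pi] by (simp_all add: t_def)
    let ?L = "{x \<in> ?H. x \<bullet> tilt e z t < 0}"
    have L: "?L \<in> sets ?\<mu>" by (rule sets_lune)
    \<comment> \<open>The upper dyadic bound \<open>pi / 2 ^ k < 2 * s\<close> controls the measure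
      of the lune; the lower one, \<open>s \<le> pi / 2 ^ k\<close>, is kept for the
      distance.\<close>
    have "1 / 2 ^ k \<le> 2 * c / pi * (ln (real n) / real n)"
      using divide_right_mono[OF less_imp_le[OF k(2)], of pi] by (simp add: s_def mult_ac)
    then have "measure ?\<mu> ?L \<le> 2 * c / pi * (ln (real n) / real n)"
      using measure_lune_le[OF ez \<mu>, of k] by (simp add: t_def)
    moreover have "measure ?\<mu> (?H - ?L) = 1 - measure ?\<mu> ?L"
      using \<mu>.prob_compl[OF L] by simp
    ultimately have compl: "1 - 2 * c / pi * (ln (real n) / real n) \<le> measure ?\<mu> (?H - ?L)" by simp
    have HL: "?H - ?L \<in> sets ?\<mu>" using sets.compl_sets[OF L] by simp
    have c2: "0 \<le> 2 * c / pi" "2 * c / pi \<le> 1 / 2"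
      using c pi_gt3 by (auto simp: field_simps)
    have "1 / real n \<le> (1 - 2 * c / pi * (ln (real n) / real n)) ^ n"
      using c2 n by (intro one_minus_power_ge_inverse) auto
    also have "\<dots> \<le> measure ?\<mu> (?H - ?L) ^ n"
    proof (intro power_mono compl)
      have "2 * c / pi * (ln (real n) / real n) \<le> 1 / 2 * 1"
        using c2 ln by (intro mult_mono) auto
      then show "0 \<le> 1 - 2 * c / pi * (ln (real n) / real n)" by simp
    qed
    also have "\<dots> = (\<Prod>i\<in>{1..n}. prob (X n i -` (?H - ?L) \<inter> space M))"
    proof -
      have "prob (X n i -` (?H - ?L) \<inter> space M) = measure ?\<mu> (?H - ?L)" if "i \<in> {1..n}" for i
        using measure_distr[OF X_meas[OF that] HL] X_distr[OF that] by simp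
      then show ?thesis by simp
    qed
    also have "\<dots> = prob (\<Inter>i\<in>{1..n}. X n i -` (?H - ?L) \<inter> space M)"
      using n HL by (intro indep_varsD_finite[OF assms(7)[of n], symmetric]) auto
    also have "\<dots> \<le> prob (E n)"
    proof (intro finite_measure_mono E_sets)
      show "(\<Inter>i\<in>{1..n}. X n i -` (?H - ?L) \<inter> space M) \<subseteq> E n"
      proof
        fix w assume w: "w \<in> (\<Inter>i\<in>{1..n}. X n i -` (?H - ?L) \<inter> space M)"
        \<comment> \<open>All points avoid the lune, so the hull misses \<open>z\<close> by at least
          \<open>t\<close>, which is at least \<open>s\<close>.\<close>
        have "t \<le> sph_hausdorff (sph_conv ((\<lambda>i. X n i w) ` {1..n})) ?H"
          using w n by (intro sph_hausdorff_ge_tilt[OF ez t]) (auto simp: not_less)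
        moreover have "w \<in> space M" using w n by auto
        ultimately show "w \<in> E n" using k(1) by (simp add: E_def s_def t_def)
      qed
    qed (use n in simp)
    finally show ?thesis .
  qed

  have "\<not> summable (\<lambda>n. prob (E n))"
  proof
    assume "summable (\<lambda>n. prob (E n))"
    then have "summable (\<lambda>n. inverse (real n))"
      using lower by (rule_tac summable_comparison_test'[of "\<lambda>n. prob (E n)" 2])
        (auto simp: inverse_eq_divide)
    then show False using not_summable_harmonic[where 'a = real] by simp
  qed
  then have AE: "AE w in M. \<exists>\<^sub>\<infinity>n. w \<in> E n"
    by (rule borel_cantelli_indep_AE[OF indep])
  let ?A = "{w \<in> space M. \<exists>\<^sub>\<infinity>n. w \<in> E n}"
  \<comment> \<open>The strict tails \<open>{m<..}\<close> avoid index 0, where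
    \<open>E_sets\<close> gives no measurability.\<close>
  have "?A = space M \<inter> (\<Inter>m. \<Union>n\<in>{m<..}. E n)"
    by (auto simp: INFM_nat Bex_def)
  also have "\<dots> \<in> events"
    using E_sets by (intro sets.Int sets.top sets.countable_INT sets.countable_UN') auto
  finally have "prob ?A = 1"
    using AE by (subst prob_Collect_eq_1) auto
  moreover have "?A = {w \<in> space M. \<exists>\<^sub>\<infinity>n.
      sph_hausdorff (sph_conv ((\<lambda>i. X n i w) ` {1..n})) ?H \<ge> c * (ln (real n) / real n)}"
    by (auto simp: E_def)
  ultimately show ?thesis by (simp add: c_def)
qed

end
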